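(* Let $b\in(0,1)$ and $Q=b+\frac1b$. For any $(a_1,\dots,a_6)\in\big(\frac Q2+\mathbf i\mathbb R\big)^6$, the integral in $$\Bigg(\frac{\prod_{i=1}^4 T_b(2Q-t_i)}{\prod_{i=1}^4\prod_{j=1}^3 T_b(q_j-t_i)}\Bigg)^{\frac12}\int_\Gamma \frac{\prod_{i=1}^4 T_b(u-t_i)}{T_b(2Q-u)}\prod_{j=1}^3S_b(q_j-u)\,d\mathrm{Im}u$$ converges absolutely for any vertical line $\Gamma$ passing through the interval $\big(\frac{11Q}6,2Q\big)$, oriented upward, and is independent of the choice of $\Gamma$.
   Context: For $z\in\mathbb C$, $T_b(z)=e^{-\frac{\pi\mathbf i}{2}(z^2-Qz+\frac{Q^2+1}{6})}$, with the convention $T_b(z)^{1/2}=e^{-\frac{\pi\mathbf i}{4}(z^2-Qz+\frac{Q^2+1}{6})}$. For $0<\mathrm{Re}(z)<Q$, $S_b(z)=\exp\Big(\int_\Omega\frac{\sinh((\frac Q2-z)t)}{4t\sinh(\frac{bt}2)\sinh(\frac t{2b})}dt\Big)$, where $\Omega$ goes along the real line and passes above the pole of the integrand at the origin. For $(a_1,\dots,a_6)$: $t_1=a_1+a_2+a_3$, $t_2=a_1+a_5+a_6$, $t_3=a_2+a_4+a_6$, $t_4=a_3+a_4+a_5$, $q_1=a_1+a_2+a_4+a_5$, $q_2=a_1+a_3+a_4+a_6$, $q_3=a_2+a_3+a_5+a_6$. *)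

theory Defs
  imports "HOL-Complex_Analysis.Complex_Analysis"
begin

definition Qb :: "real \<Rightarrow> real" where
  "Qb b = b + 1 / b"

definition T_b :: "real \<Rightarrow> complex \<Rightarrow> complex" where
  "T_b b z = exp (- (of_real pi * \<i> / 2) *
     (z\<^sup>2 - of_real (Qb b) * z + of_real (((Qb b)\<^sup>2 + 1) / 6)))"

text \<open>The branch of the square root of \<open>T_b b z\<close> fixed by convention.\<close>
definition sqrt_T_b :: "real \<Rightarrow> complex \<Rightarrow> complex" where
  "sqrt_T_b b z = exp (- (of_real pi * \<i> / 4) *
     (z\<^sup>2 - of_real (Qb b) * z + of_real (((Qb b)\<^sup>2 + 1) / 6)))"

definition S_integrand :: "real \<Rightarrow> complex \<Rightarrow> complex \<Rightarrow> complex" where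
  "S_integrand b z t = sinh ((of_real (Qb b) / 2 - z) * t) /
     (4 * t * sinh (of_real b * t / 2) * sinh (t / (2 * of_real b)))"

text \<open>
  Integral along \<open>\<Omega>\<close>: the real line with the segment from \<open>- r\<close> to \<open>r\<close> replaced by the
  upper half circle from \<open>- r\<close> to \<open>r\<close>.
\<close>
definition Omega_integral :: "real \<Rightarrow> (complex \<Rightarrow> complex) \<Rightarrow> complex" where
  "Omega_integral r f =
     (LINT t:{..- r}|lborel. f (of_real t)) +
     contour_integral (part_circlepath 0 r pi 0) f +
     (LINT t:{r..}|lborel. f (of_real t))"

text \<open>
  Only meaningful for \<open>0 < Re z < Qb b\<close>, where the two tails converge absolutely.
  The nonzero poles of the integrand lie at \<open>2 * pi * \<i> * k * b\<close> and \<open>2 * pi * \<i> * k / b\<close>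
  for nonzero integers \<open>k\<close>; for \<open>0 < b < 1\<close> the radius \<open>pi * b\<close> therefore separates the
  origin from all of them.
\<close>
definition S_b :: "real \<Rightarrow> complex \<Rightarrow> complex" where
  "S_b b z = exp (Omega_integral (pi * b) (S_integrand b z))"

text \<open>The six parameters are \<open>a 1, \<dots>, a 6\<close>; \<open>tt a i\<close> is used for \<open>i \<in> {1..4}\<close> and
  \<open>qq a j\<close> for \<open>j \<in> {1..3}\<close>.\<close>
definition tt :: "(nat \<Rightarrow> complex) \<Rightarrow> nat \<Rightarrow> complex" where
  "tt a i = (if i = 1 then a 1 + a 2 + a 3
     else if i = 2 then a 1 + a 5 + a 6
     else if i = 3 then a 2 + a 4 + a 6
     else a 3 + a 4 + a 5)"

definition qq :: "(nat \<Rightarrow> complex) \<Rightarrow> nat \<Rightarrow> complex" where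
  "qq a j = (if j = 1 then a 1 + a 2 + a 4 + a 5
     else if j = 2 then a 1 + a 3 + a 4 + a 6
     else a 2 + a 3 + a 5 + a 6)"

definition sixj_prefactor :: "real \<Rightarrow> (nat \<Rightarrow> complex) \<Rightarrow> complex" where
  "sixj_prefactor b a =
     (\<Prod>i=1..4. sqrt_T_b b (2 * of_real (Qb b) - tt a i)) /
     (\<Prod>i=1..4. \<Prod>j=1..3. sqrt_T_b b (qq a j - tt a i))"

definition sixj_integrand :: "real \<Rightarrow> (nat \<Rightarrow> complex) \<Rightarrow> complex \<Rightarrow> complex" where
  "sixj_integrand b a u =
     (\<Prod>i=1..4. T_b b (u - tt a i)) / T_b b (2 * of_real (Qb b) - u) *
     (\<Prod>j=1..3. S_b b (qq a j - u))"

text \<open>The integral with respect to \<open>d Im u\<close> over the upward vertical line \<open>Re u = c\<close>.\<close>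
definition sixj_integral :: "real \<Rightarrow> (nat \<Rightarrow> complex) \<Rightarrow> real \<Rightarrow> complex" where
  "sixj_integral b a c = (LINT y|lborel. sixj_integrand b a (Complex c y))"

end

theory Submission
  imports Defs
begin

text \<open>
  Write \<open>Q = Qb b\<close>.  On the contour, \<open>q\<^sub>j - u\<close> has real part \<open>2 * Q - Re u\<close>, which lies in
  \<open>(0, Q / 6)\<close>, so \<open>S_b\<close> is only evaluated inside the strip \<open>0 < Re z < Q\<close>.  Two facts about
  \<open>S_b\<close> on that strip suffice: it is holomorphic (\<open>S_b_holomorphic\<close>), and
  \<open>\<bar>S_b(z)\<bar> \<le> C * exp (- pi * (Q / 2 - Re z) * \<bar>Im z\<bar>)\<close> with \<open>C\<close> uniform for \<open>Re z\<close> in compact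
  subintervals of \<open>(0, Q)\<close> (\<open>norm_S_b_le\<close>).

  For the bound put \<open>w = Q / 2 - z\<close>.  The integrand of \<open>log S_b\<close> is \<open>sinh (w * t)\<close> times a kernel
  with a triple pole at the origin, and \<open>\<Omega>\<close> consists of two real half lines and a half circle.
  On the half lines \<open>\<bar>sinh (w * t)\<bar> \<le> exp (\<bar>Re w * t\<bar>)\<close> while the kernel decays like
  \<open>exp (- Q * \<bar>t\<bar> / 2)\<close>, so they contribute an amount bounded in terms of \<open>Re w\<close> (\<open>tail_bounds\<close>).
  On the half circle write \<open>sinh\<close> as a difference of two exponentials.  One of them is bounded on the upper half circle, the other one on the lower half
  circle; moving the latter from the upper to the lower half circle produces the residue at
  the origin, a quadratic polynomial in \<open>w\<close> (\<open>circle_integral_exp_kern\<close>).  The real part of this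
  residue term is \<open>- pi * Re w * \<bar>Im w\<bar>\<close> up to a constant (\<open>Re_arc_integral_le\<close>).

  Since \<open>\<bar>T_b\<bar>\<close> is explicit, multiplying the bounds shows that the integrand decays exponentially
  on vertical lines, at least at the rate \<open>pi * (6 * c - 11 * Q)\<close>, uniformly for \<open>Re u\<close> between
  \<open>c > 11 * Q / 6\<close> and any \<open>c' < 2 * Q\<close> (\<open>norm_sixj_integrand_le\<close>).  This gives absolute
  convergence, and independence of the line follows from Cauchy's theorem on a strip
  (\<open>vertical_line_integral_shift\<close>).
\<close>

section \<open>The kernel of the double sine integral\<close>

text \<open>The entire function \<open>sinh z / z\<close>, with the value 1 filled in at the origin.\<close>

definition sinhc :: "complex \<Rightarrow> complex" where
  "sinhc z = (if z = 0 then 1 else sinh z / z)"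

lemma sinh_eq_exp: "sinh (x::complex) = (exp x - exp (- x)) / 2"
  by (simp add: sinh_def scaleR_conv_of_real)

lemma sinhc_holomorphic: "sinhc holomorphic_on UNIV"
proof -
  have d: "deriv sinh (0::complex) = 1"
    by (rule DERIV_imp_deriv) (auto intro!: derivative_eq_intros)
  have "sinh holomorphic_on (UNIV::complex set)"
    unfolding sinh_eq_exp[abs_def] by (intro holomorphic_intros) auto
  then have "(\<lambda>z. if z = 0 then deriv sinh 0 else (sinh z - sinh 0) / (z - 0)) holomorphic_on (UNIV::complex set)"
    by (rule pole_lemma) auto
  then show ?thesis
    by (rule holomorphic_transform) (simp add: sinhc_def d)
qed

lemma sinhc_minus [simp]: "sinhc (- z) = sinhc z"
  by (simp add: sinhc_def)

lemma sinhc_nonzero: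
  assumes "norm z < pi"
  shows "sinhc z \<noteq> 0"
proof
  assume h: "sinhc z = 0"
  then have z0: "z \<noteq> 0" and "sinh z = 0"
    by (auto simp: sinhc_def split: if_splits)
  then have "sin (\<i> * z) = 0"
    by (simp add: sinh_conv_sin)
  then obtain n :: int where n: "\<i> * z = of_real (of_int n * pi)"
    by (auto simp: sin_eq_0)
  then have e: "norm z = \<bar>of_int n\<bar> * pi"
    by (metis abs_mult abs_of_pos norm_ii norm_mult norm_of_real mult_1 pi_gt_zero)
  with z0 have "n \<noteq> 0" by auto
  then have "\<bar>of_int n\<bar> \<ge> (1::real)" by linarith
  then have "\<bar>of_int n\<bar> * pi \<ge> 1 * pi" by (intro mult_right_mono) auto
  with e assms show False by simp
qed

text \<open>The part of the integrand of \<open>S_b\<close> that does not depend on \<open>z\<close>; the other factor is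
  \<open>sinh (w * t)\<close> with \<open>w = Q / 2 - z\<close>.\<close>

definition kern :: "real \<Rightarrow> complex \<Rightarrow> complex" where
  "kern b t = 1 / (4 * t * sinh (of_real b * t / 2) * sinh (t / (2 * of_real b)))"

text \<open>The regular part of the kernel at its triple pole: \<open>kern b t = kern_reg b t / t ^ 3\<close>.
  It is even, takes the value 1 at the origin and is holomorphic up to the nearest nonzero pole.\<close>

definition kern_reg :: "real \<Rightarrow> complex \<Rightarrow> complex" where
  "kern_reg b t = 1 / (sinhc (of_real b * t / 2) * sinhc (t / (2 * of_real b)))"

lemma kern_reg_eq:
  assumes "b > 0"
  shows "kern b t = kern_reg b t / t ^ 3"
  using assms by (simp add: kern_def kern_reg_def sinhc_def power3_eq_cube)

lemma kern_reg_0 [simp]: "kern_reg b 0 = 1"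
  by (simp add: kern_reg_def sinhc_def)

lemma kern_reg_minus: "kern_reg b (- t) = kern_reg b t"
  by (simp add: kern_reg_def)

lemma kern_minus: "kern b (- t) = - kern b t"
  by (simp add: kern_def)

lemma kern_reg_holomorphic:
  assumes "0 < b" "b < 1"
  shows "kern_reg b holomorphic_on ball 0 (2 * pi * b)"
proof -
  have 1: "sinhc (of_real b * t / 2) \<noteq> 0" if "norm t < 2 * pi * b" for t
  proof (rule sinhc_nonzero)
    have "norm (of_real b * t / 2) = b * norm t / 2" using assms by (simp add: norm_mult norm_divide)
    also have "\<dots> \<le> 1 * norm t / 2" using assms by (intro divide_right_mono mult_right_mono) auto
    also have "\<dots> < pi * b" using that by simp
    also have "\<dots> < pi * 1" using assms by (intro mult_strict_left_mono) auto
    finally show "norm (of_real b * t / 2) < pi" by simp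
  qed
  have 2: "sinhc (t / (2 * of_real b)) \<noteq> 0" if "norm t < 2 * pi * b" for t
  proof (rule sinhc_nonzero)
    show "norm (t / (2 * of_real b)) < pi"
      using that assms by (simp add: norm_mult norm_divide field_simps)
  qed
  have 3: "(\<lambda>t. sinhc (of_real b * t / 2)) holomorphic_on ball 0 (2 * pi * b)"
       "(\<lambda>t. sinhc (t / (2 * of_real b))) holomorphic_on ball 0 (2 * pi * b)"
    using assms
    by (auto intro!: holomorphic_intros holomorphic_on_compose_gen[OF _ sinhc_holomorphic, unfolded o_def])
  show ?thesis
    unfolding kern_reg_def using 1 2 by (intro holomorphic_intros 3) auto
qed

lemma higher_deriv_exp_linear:
  "(deriv ^^ n) (\<lambda>t. exp (w * t)) = (\<lambda>t. w ^ n * exp (w * t :: complex))"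
proof (induction n)
  case (Suc n)
  have "deriv (\<lambda>t. w ^ n * exp (w * t)) t = w ^ Suc n * exp (w * t)" for t
    by (rule DERIV_imp_deriv) (auto intro!: derivative_eq_intros)
  then show ?case using Suc by auto
qed simp

text \<open>The residue of \<open>exp (w * t) * kern b t\<close> at the origin is a quadratic polynomial in \<open>w\<close>
  with leading coefficient 1/2.  It has no linear term because the regular part of the kernel
  is even.  This polynomial is the source of the exponential growth and
  decay of \<open>S_b\<close>.\<close>

lemma circle_integral_exp_kern:
  assumes "0 < b" "b < 1"
  shows "((\<lambda>t. exp (w * t) * kern b t) has_contour_integral
           (pi * \<i> * (w\<^sup>2 + (deriv ^^ 2) (kern_reg b) 0))) (circlepath 0 (pi * b))"
proof -
  let ?B = "ball (0::complex) (2 * pi * b)" and ?f = "\<lambda>t. exp (w * t) * kern_reg b t"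
  have "0 < pi * b" using assms by simp
  then have sub: "cball 0 (pi * b) \<subseteq> ?B" by auto
  have hol: "?f holomorphic_on ?B"
    by (intro holomorphic_intros kern_reg_holomorphic assms)
  have z: "(0::complex) \<in> ?B" using assms by auto
  have "deriv (kern_reg b) 0 = 0"
  proof -
    obtain d where d: "(kern_reg b has_field_derivative d) (at 0)"
      using kern_reg_holomorphic[OF assms] z
      by (meson field_differentiable_def holomorphic_on_imp_differentiable_at open_ball)
    then have "((\<lambda>t. kern_reg b (- t)) has_field_derivative d * (- 1)) (at 0)"
      by (intro DERIV_chain'[where f = uminus and g = "kern_reg b"]) (auto intro!: derivative_eq_intros)
    then have "(kern_reg b has_field_derivative - d) (at 0)"
      by (simp add: kern_reg_minus)
    with d have "d = - d" by (rule DERIV_unique)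
    then have "d = 0" by simp
    with d show ?thesis by (simp add: DERIV_imp_deriv)
  qed
  moreover have "(deriv ^^ 2) ?f 0 = (\<Sum>i=0..2. of_nat (2 choose i) * (deriv ^^ i) (\<lambda>t. exp (w * t)) 0 *
      (deriv ^^ (2 - i)) (kern_reg b) 0)"
    by (rule higher_deriv_mult[where S = ?B]) (use z kern_reg_holomorphic[OF assms] in \<open>auto intro!: holomorphic_intros\<close>)
  ultimately have d2: "(deriv ^^ 2) ?f 0 = w\<^sup>2 + (deriv ^^ 2) (kern_reg b) 0"
    by (simp add: higher_deriv_exp_linear eval_nat_numeral)
  have "((\<lambda>u. ?f u / (u - 0) ^ Suc 2) has_contour_integral (2 * pi * \<i>) / (fact 2) * (deriv ^^ 2) ?f 0)
           (circlepath 0 (pi * b))"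
    by (rule Cauchy_has_contour_integral_higher_derivative_circlepath)
      (use sub assms in \<open>auto intro!: holomorphic_on_subset[OF hol] holomorphic_on_imp_continuous_on\<close>)
  then show ?thesis
    unfolding d2 using assms by (simp add: kern_reg_eq eval_nat_numeral)
qed

lemma S_integrand_eq:
  "S_integrand b z t = sinh ((of_real (Qb b) / 2 - z) * t) * kern b t"
  by (simp add: S_integrand_def kern_def)

section \<open>The half circle around the origin\<close>

lemma continuous_on_kern_circle:
  assumes "0 < b" "b < 1"
  shows "continuous_on S (\<lambda>\<theta>. kern b (of_real (pi * b) * cis \<theta>))"
proof -
  have n: "norm (of_real (pi * b) * cis \<theta>) = pi * b" for \<theta>
    using assms by (simp add: norm_mult)
  have "continuous_on (ball 0 (2 * pi * b)) (kern_reg b)"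
    by (intro holomorphic_on_imp_continuous_on kern_reg_holomorphic assms)
  then have "continuous_on S (\<lambda>\<theta>. kern_reg b (of_real (pi * b) * cis \<theta>))"
    by (rule continuous_on_compose2) (use assms n in \<open>auto intro!: continuous_intros simp del: of_real_mult\<close>)
  then show ?thesis
    unfolding kern_reg_eq[OF assms(1)] using assms
    by (intro continuous_intros) auto
qed

text \<open>On an arc where \<open>Im w\<close> and \<open>sin \<theta>\<close> do not have opposite signs, the oscillating factor
  \<open>exp (\<i> * Im w * t)\<close> has modulus at most 1, so the integral is bounded uniformly in \<open>Im w\<close>.\<close>

lemma norm_integral_exp_cis_le:
  assumes K: "continuous_on {\<alpha>..\<beta>} K" and M: "\<And>\<theta>. \<theta> \<in> {\<alpha>..\<beta>} \<Longrightarrow> norm (K \<theta>) \<le> M"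
    and r: "0 \<le> r" and A: "\<bar>Re w\<bar> \<le> A" and s: "\<And>\<theta>. \<theta> \<in> {\<alpha>..\<beta>} \<Longrightarrow> 0 \<le> Im w * sin \<theta>"
    and ab: "\<alpha> \<le> \<beta>"
  shows "norm (integral {\<alpha>..\<beta>} (\<lambda>\<theta>. exp (w * (of_real r * cis \<theta>)) * K \<theta>)) \<le> exp (A * r) * M * (\<beta> - \<alpha>)"
proof (rule integral_bound[OF ab])
  show "continuous_on {\<alpha>..\<beta>} (\<lambda>\<theta>. exp (w * (of_real r * cis \<theta>)) * K \<theta>)"
    by (intro continuous_intros K)
  fix \<theta> assume t: "\<theta> \<in> {\<alpha>..\<beta>}"
  have "Re (w * (of_real r * cis \<theta>)) = r * (Re w * cos \<theta>) - r * (Im w * sin \<theta>)"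
    by (simp add: algebra_simps)
  also have "\<dots> \<le> r * (Re w * cos \<theta>)" using s[OF t] r by (auto intro: mult_nonneg_nonneg)
  also have "\<dots> \<le> r * A"
  proof (intro mult_left_mono r)
    have "Re w * cos \<theta> \<le> \<bar>Re w\<bar> * \<bar>cos \<theta>\<bar>" by (metis abs_ge_self abs_mult)
    also have "\<dots> \<le> \<bar>Re w\<bar> * 1" by (intro mult_left_mono) auto
    finally show "Re w * cos \<theta> \<le> A" using A by simp
  qed
  finally have "norm (exp (w * (of_real r * cis \<theta>))) \<le> exp (A * r)"
    unfolding norm_exp_eq_Re by (simp add: mult.commute)
  then show "norm (exp (w * (of_real r * cis \<theta>)) * K \<theta>) \<le> exp (A * r) * M"
    unfolding norm_mult using M[OF t] by (intro mult_mono) auto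
qed

text \<open>The kernel times the velocity of the circle of radius \<open>pi * b\<close> at the angle \<open>\<theta>\<close>.\<close>

definition arc_weight :: "real \<Rightarrow> real \<Rightarrow> complex" where
  "arc_weight b \<theta> = kern b (of_real (pi * b) * cis \<theta>) * of_real (pi * b) * \<i> * cis \<theta>"

text \<open>The integral of \<open>exp (w * t) * kern b t\<close> along the counterclockwise arc of radius \<open>pi * b\<close>
  from the angle \<open>\<alpha>\<close> to the angle \<open>\<beta>\<close>.\<close>

definition arc_exp :: "real \<Rightarrow> real \<Rightarrow> real \<Rightarrow> complex \<Rightarrow> complex" where
  "arc_exp b \<alpha> \<beta> w = integral {\<alpha>..\<beta>} (\<lambda>\<theta>. exp (w * (of_real (pi * b) * cis \<theta>)) * arc_weight b \<theta>)"

lemma continuous_on_arc_weight: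
  assumes "0 < b" "b < 1"
  shows "continuous_on S (arc_weight b)"
  unfolding arc_weight_def by (intro continuous_intros continuous_on_kern_circle assms)

lemma arc_exp_has_integral:
  assumes "0 < b" "b < 1"
  shows "((\<lambda>\<theta>. exp (w * (of_real (pi * b) * cis \<theta>)) * arc_weight b \<theta>) has_integral arc_exp b \<alpha> \<beta> w) {\<alpha>..\<beta>}"
  unfolding arc_exp_def
  by (intro integrable_integral integrable_continuous_real continuous_intros continuous_on_arc_weight assms)

lemma arc_exp_sum:
  assumes "0 < b" "b < 1"
  shows "arc_exp b 0 pi w + arc_exp b pi (2 * pi) w = pi * \<i> * (w\<^sup>2 + (deriv ^^ 2) (kern_reg b) 0)"
proof -
  let ?h = "\<lambda>\<theta>. exp (w * (of_real (pi * b) * cis \<theta>)) * arc_weight b \<theta>"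
  have "(?h has_integral arc_exp b 0 pi w + arc_exp b pi (2 * pi) w) {0..2 * pi}"
    by (rule has_integral_combine[OF _ _ arc_exp_has_integral arc_exp_has_integral]) (use assms in auto)
  moreover have "(?h has_integral pi * \<i> * (w\<^sup>2 + (deriv ^^ 2) (kern_reg b) 0)) {0..2 * pi}"
    using circle_integral_exp_kern[OF assms, of w]
    unfolding circlepath_def
    by (subst (asm) has_contour_integral_part_circlepath_iff) (auto simp: arc_weight_def algebra_simps)
  ultimately show ?thesis by (rule has_integral_unique)
qed

lemma arc_sinh_has_integral:
  assumes "0 < b" "b < 1"
  shows "((\<lambda>\<theta>. sinh (w * (of_real (pi * b) * cis \<theta>)) * arc_weight b \<theta>)
         has_integral (arc_exp b \<alpha> \<beta> w - arc_exp b \<alpha> \<beta> (- w)) / 2) {\<alpha>..\<beta>}"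
proof -
  have "((\<lambda>\<theta>. (exp (w * (of_real (pi * b) * cis \<theta>)) * arc_weight b \<theta> -
             exp (- w * (of_real (pi * b) * cis \<theta>)) * arc_weight b \<theta>) / 2)
         has_integral (arc_exp b \<alpha> \<beta> w - arc_exp b \<alpha> \<beta> (- w)) / 2) {\<alpha>..\<beta>}"
    by (intro has_integral_divide has_integral_diff arc_exp_has_integral assms)
  then show ?thesis
    by (simp add: sinh_eq_exp field_simps)
qed

lemma arc_integral_eq:
  assumes "0 < b" "b < 1"
  shows "contour_integral (part_circlepath 0 (pi * b) pi 0) (\<lambda>t. sinh (w * t) * kern b t)
           = (arc_exp b 0 pi (- w) - arc_exp b 0 pi w) / 2"
proof -
  have "((\<lambda>t. sinh (w * t) * kern b t) has_contour_integral (arc_exp b 0 pi w - arc_exp b 0 pi (- w)) / 2)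
      (part_circlepath 0 (pi * b) 0 pi)"
    using arc_sinh_has_integral[OF assms, of w]
    by (subst has_contour_integral_part_circlepath_iff) (auto simp: arc_weight_def algebra_simps)
  from has_contour_integral_reversepath[OF _ this]
  have "((\<lambda>t. sinh (w * t) * kern b t) has_contour_integral - ((arc_exp b 0 pi w - arc_exp b 0 pi (- w)) / 2))
      (part_circlepath 0 (pi * b) pi 0)"
    by simp
  then show ?thesis
    by (simp add: contour_integral_unique field_simps)
qed

text \<open>The only growth in \<open>Im w\<close> comes from the half circle.  Split \<open>sinh\<close> into two exponentials.
  One is bounded on the upper half circle; the other is bounded on the lower half circle, and
  passing from one half circle to the other costs the residue at the origin.\<close>

lemma Re_arc_integral_le:
  assumes b: "0 < b" "b < 1"
  obtains C where "\<And>w. \<bar>Re w\<bar> \<le> A \<Longrightarrow>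
     Re (contour_integral (part_circlepath 0 (pi * b) pi 0) (\<lambda>t. sinh (w * t) * kern b t))
       \<le> C - pi * Re w * \<bar>Im w\<bar>"
proof -
  define c where "c = (deriv ^^ 2) (kern_reg b) 0"
  have "compact (arc_weight b ` {0..2*pi})"
    by (intro compact_continuous_image continuous_on_arc_weight b) auto
  then obtain M where M: "\<And>\<theta>. \<theta> \<in> {0..2*pi} \<Longrightarrow> norm (arc_weight b \<theta>) \<le> M"
    using compact_imp_bounded bounded_iff by (metis imageI)
  define B where "B = exp (A * (pi * b)) * M * pi"
  have U: "norm (arc_exp b 0 pi w) \<le> B" if "\<bar>Re w\<bar> \<le> A" "Im w \<ge> 0" for w
  proof -
    have "norm (arc_exp b 0 pi w) \<le> exp (A * (pi * b)) * M * (pi - 0)"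
      unfolding arc_exp_def
      by (rule norm_integral_exp_cis_le)
        (use that M b in \<open>auto intro!: continuous_on_arc_weight mult_nonneg_nonneg sin_ge_zero\<close>)
    then show ?thesis by (simp add: B_def)
  qed
  have L: "norm (arc_exp b pi (2*pi) w) \<le> B" if "\<bar>Re w\<bar> \<le> A" "Im w \<le> 0" for w
  proof -
    have sin_le: "sin \<theta> \<le> 0" if "pi \<le> \<theta>" "\<theta> \<le> 2 * pi" for \<theta> :: real
      using sin_ge_zero[of "\<theta> - pi"] that by (simp add: sin_diff)
    have "norm (arc_exp b pi (2*pi) w) \<le> exp (A * (pi * b)) * M * (2 * pi - pi)"
      unfolding arc_exp_def
      by (rule norm_integral_exp_cis_le)
        (use that M b sin_le in \<open>auto intro!: continuous_on_arc_weight mult_nonpos_nonpos\<close>)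
    then show ?thesis by (simp add: B_def)
  qed
  \<comment> \<open>The upper arc is the full circle minus the lower arc, and the real part of
    \<open>pi * \<i> * w\<^sup>2\<close> is \<open>- 2 * pi * Re w * Im w\<close>.\<close>
  have J: "\<bar>Re (arc_exp b 0 pi w) + 2 * pi * Re w * Im w\<bar> \<le> B + pi * norm c"
    if "\<bar>Re w\<bar> \<le> A" "Im w \<le> 0" for w
  proof -
    have e: "arc_exp b 0 pi w = pi * \<i> * (w\<^sup>2 + c) - arc_exp b pi (2*pi) w"
      using arc_exp_sum[OF b, of w] unfolding c_def[symmetric] by (simp add: algebra_simps)
    have 1: "\<bar>Re (arc_exp b pi (2*pi) w)\<bar> \<le> B" using L[OF that] abs_Re_le_cmod order_trans by blast
    have 2: "\<bar>pi * Im c\<bar> \<le> pi * norm c" by (simp add: abs_mult abs_Im_le_cmod)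
    have "Re (arc_exp b 0 pi w) + 2 * pi * Re w * Im w = - pi * Im c - Re (arc_exp b pi (2*pi) w)"
      unfolding e by (simp add: power2_eq_square algebra_simps)
    then show ?thesis using 1 2 by linarith
  qed
  show ?thesis
  proof (rule that[of "B + pi * norm c / 2"])
    fix w assume w: "\<bar>Re w\<bar> \<le> A"
    have up: "Re (arc_exp b 0 pi v) \<le> B" "- Re (arc_exp b 0 pi v) \<le> B" if "\<bar>Re v\<bar> \<le> A" "Im v \<ge> 0" for v
      using U[OF that] complex_Re_le_cmod[of "arc_exp b 0 pi v"] abs_Re_le_cmod[of "arc_exp b 0 pi v"] by linarith+
    have e: "Re (contour_integral (part_circlepath 0 (pi * b) pi 0) (\<lambda>t. sinh (w * t) * kern b t))
        = (Re (arc_exp b 0 pi (- w)) - Re (arc_exp b 0 pi w)) / 2"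
      unfolding arc_integral_eq[OF b] by simp
    have "2 * Re (contour_integral (part_circlepath 0 (pi * b) pi 0) (\<lambda>t. sinh (w * t) * kern b t))
        \<le> 2 * B + pi * norm c - 2 * pi * Re w * \<bar>Im w\<bar>"
    proof (cases "Im w \<le> 0")
      case True
      then show ?thesis using J[of w] up(1)[of "- w"] w unfolding e by (simp add: abs_le_iff)
    next
      case False
      then show ?thesis using J[of "- w"] up(2)[of w] w unfolding e by (simp add: abs_le_iff)
    qed
    then show "Re (contour_integral (part_circlepath 0 (pi * b) pi 0) (\<lambda>t. sinh (w * t) * kern b t))
        \<le> B + pi * norm c / 2 - pi * Re w * \<bar>Im w\<bar>" by simp
  qed
qed

section \<open>The tails of the double sine integral\<close>

lemma sinh_ge_exp:
  assumes "0 < (x0::real)" "x0 \<le> x"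
  shows "(1 - exp (- 2 * x0)) / 2 * exp x \<le> sinh x"
proof -
  have "exp (- 2 * x) * exp x \<le> exp (- 2 * x0) * exp x" using assms by (intro mult_right_mono) auto
  also have "exp (- 2 * x) * exp x = exp (- x)" by (simp flip: exp_add)
  finally show ?thesis by (simp add: sinh_def field_simps)
qed

lemma norm_sinh_le: "norm (sinh (z::complex)) \<le> exp \<bar>Re z\<bar>"
proof -
  have "norm (sinh z) \<le> (norm (exp z) + norm (exp (- z))) / 2"
    unfolding sinh_eq_exp using norm_triangle_ineq4[of "exp z" "exp (- z)"] by (simp add: norm_divide)
  also have "\<dots> \<le> exp \<bar>Re z\<bar>"
  proof -
    have "exp (Re z) \<le> exp \<bar>Re z\<bar>" "exp (- Re z) \<le> exp \<bar>Re z\<bar>" by simp_all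
    then show ?thesis unfolding norm_exp_eq_Re by (simp del: exp_le_cancel_iff)
  qed
  finally show ?thesis .
qed

lemma sinh_of_real: "sinh (complex_of_real x) = of_real (sinh x)"
  by (simp add: sinh_def scaleR_conv_of_real flip: exp_of_real)

text \<open>On the positive real axis, away from the origin, the kernel decays like \<open>exp (- Q * t / 2)\<close>,
  since \<open>b / 2 + 1 / (2 * b) = Q / 2\<close>.\<close>

lemma norm_kern_real_le:
  assumes "0 < b"
  obtains C where "0 \<le> C" "\<And>t. pi * b \<le> t \<Longrightarrow> norm (kern b (of_real t)) \<le> C * exp (- (Qb b / 2) * t)"
proof -
  define r where "r = pi * b"
  define k1 where "k1 = (1 - exp (- 2 * (b * r / 2))) / 2"
  define k2 where "k2 = (1 - exp (- 2 * (r / (2 * b)))) / 2"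
  have r: "r > 0" using assms by (simp add: r_def)
  have k: "k1 > 0" "k2 > 0" using assms r by (auto simp: k1_def k2_def)
  show ?thesis
  proof (rule that[of "1 / (4 * r * k1 * k2)"])
    show "0 \<le> 1 / (4 * r * k1 * k2)" using k r by simp
    fix t assume "pi * b \<le> t"
    then have t: "r \<le> t" by (simp add: r_def)
    have s1: "k1 * exp (b * t / 2) \<le> sinh (b * t / 2)"
      unfolding k1_def using assms r t by (intro sinh_ge_exp) auto
    have s2: "k2 * exp (t / (2 * b)) \<le> sinh (t / (2 * b))"
      unfolding k2_def using assms r t by (intro sinh_ge_exp) (auto simp: divide_right_mono)
    have e: "exp (b * t / 2) * exp (t / (2 * b)) = exp (Qb b / 2 * t)"
      using assms by (simp add: Qb_def field_simps flip: exp_add)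
    have "4 * r * k1 * k2 * exp (Qb b / 2 * t) = 4 * r * (k1 * exp (b * t / 2)) * (k2 * exp (t / (2 * b)))"
      unfolding e[symmetric] by (simp only: mult_ac)
    also have "\<dots> \<le> 4 * t * sinh (b * t / 2) * sinh (t / (2 * b))"
      using s1 s2 k r t assms by (intro mult_mono) auto
    finally have le: "4 * r * k1 * k2 * exp (Qb b / 2 * t) \<le> 4 * t * sinh (b * t / 2) * sinh (t / (2 * b))" .
    have pos: "0 < 4 * r * k1 * k2 * exp (Qb b / 2 * t)" using k r by simp
    have "kern b (of_real t) = of_real (1 / (4 * t * sinh (b * t / 2) * sinh (t / (2 * b))))"
      by (simp add: kern_def flip: sinh_of_real)
    also have "norm \<dots> = 1 / (4 * t * sinh (b * t / 2) * sinh (t / (2 * b)))"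
      unfolding norm_of_real by (rule abs_of_nonneg) (use order.trans[OF less_imp_le[OF pos] le] in \<open>rule divide_nonneg_nonneg[OF zero_le_one]\<close>)
    also have "\<dots> \<le> 1 / (4 * r * k1 * k2 * exp (Qb b / 2 * t))"
      by (rule frac_le[OF zero_le_one order_refl pos le])
    also have "\<dots> = 1 / (4 * r * k1 * k2) * exp (- (Qb b / 2) * t)"
    proof -
      have "exp (- (Qb b / 2) * t) = 1 / exp (Qb b / 2 * t)"
        using exp_minus[of "Qb b / 2 * t"] by (simp add: inverse_eq_divide)
      then show ?thesis by simp
    qed
    finally show "norm (kern b (of_real t)) \<le> 1 / (4 * r * k1 * k2) * exp (- (Qb b / 2) * t)" .
  qed
qed

lemma norm_tail_integrand_le:
  assumes "norm (kern b (of_real t)) \<le> C * exp (- (Qb b / 2) * t)" "\<bar>Re w\<bar> \<le> A" "0 \<le> t" "0 \<le> C"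
  shows "norm (sinh (w * of_real t) * kern b (of_real t)) \<le> C * exp (- (Qb b / 2 - A) * t)"
proof -
  have "norm (sinh (w * of_real t)) \<le> exp (\<bar>Re (w * of_real t)\<bar>)" by (rule norm_sinh_le)
  also have "\<dots> \<le> exp (A * t)" using assms by (simp add: abs_mult mult_right_mono)
  finally have "norm (sinh (w * of_real t)) * norm (kern b (of_real t)) \<le> exp (A * t) * (C * exp (- (Qb b / 2) * t))"
    using assms by (intro mult_mono) auto
  also have "\<dots> = C * (exp (A * t) * exp (- (Qb b / 2) * t))" by simp
  also have "exp (A * t) * exp (- (Qb b / 2) * t) = exp (- (Qb b / 2 - A) * t)"
    unfolding exp_add[symmetric] by (simp add: algebra_simps)
  finally show ?thesis by (simp add: norm_mult)
qed

lemma set_integrable_exp_decay: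
  assumes "0 < (a::real)"
  shows "set_integrable lborel {c..} (\<lambda>t. C * exp (- a * t))"
    and "(LINT t:{c..}|lborel. C * exp (- a * t)) = C * exp (- a * c) / a"
proof -
  have i: "((\<lambda>t. exp (- a * t)) has_integral exp (- a * c) / a) {c..}"
    by (rule has_integral_exp_minus_to_infinity[OF assms])
  then have "(\<lambda>t. exp (- a * t)) absolutely_integrable_on {c..}"
    by (intro nonnegative_absolutely_integrable_1) auto
  then have s: "set_integrable lborel {c..} (\<lambda>t. exp (- a * t))"
    unfolding set_integrable_def by (subst (asm) integrable_completion) auto
  then show 1: "set_integrable lborel {c..} (\<lambda>t. C * exp (- a * t))" by simp
  show "(LINT t:{c..}|lborel. C * exp (- a * t)) = C * exp (- a * c) / a"
    using set_borel_integral_eq_integral(2)[OF s] integral_unique[OF i] by simp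
qed

lemma continuous_on_sinh_of_real_mult:
  "continuous_on S (\<lambda>t. sinh (w * complex_of_real t))"
  unfolding sinh_eq_exp by (intro continuous_intros) auto

lemma continuous_on_kern_real:
  assumes "0 < b" "0 \<notin> S"
  shows "continuous_on S (\<lambda>t. kern b (complex_of_real t))"
proof -
  have nz: "sinh (complex_of_real x) \<noteq> 0" if "x \<noteq> 0" for x
    using that by (simp add: sinh_of_real)
  have "4 * complex_of_real t * sinh (of_real b * of_real t / 2) * sinh (of_real t / (2 * of_real b)) \<noteq> 0"
    if "t \<in> S" for t
    using nz[of "b * t / 2"] nz[of "t / (2 * b)"] that assms by auto
  then show ?thesis
    unfolding kern_def
    by (intro continuous_intros) (auto simp: sinh_eq_exp intro!: continuous_intros assms(1))
qed

lemma set_integrable_bounded_by: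
  fixes f :: "real \<Rightarrow> complex" and g :: "real \<Rightarrow> real"
  assumes "continuous_on S f" "S \<in> sets borel" "set_integrable lborel S g" "\<And>t. t \<in> S \<Longrightarrow> norm (f t) \<le> g t"
  shows "set_integrable lborel S f"
    and "norm (LINT t:S|lborel. f t) \<le> (LINT t:S|lborel. g t)"
proof -
  have m: "set_borel_measurable lborel S f"
    unfolding set_borel_measurable_def using borel_measurable_continuous_on_indicator[OF assms(2,1)] by simp
  show i: "set_integrable lborel S f"
    by (rule set_integrable_bound[OF assms(3) m]) (use order_trans[OF assms(4) abs_ge_self] in \<open>auto intro!: AE_I2\<close>)
  have "norm (LINT t:S|lborel. f t) \<le> (LINT t:S|lborel. norm (f t))"
    by (rule set_integral_norm_bound[OF i])
  also have "\<dots> \<le> (LINT t:S|lborel. g t)"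
    by (rule set_integral_mono) (use i assms in \<open>auto intro: set_integrable_norm\<close>)
  finally show "norm (LINT t:S|lborel. f t) \<le> (LINT t:S|lborel. g t)" .
qed

lemma sinh_transform_holomorphic:
  assumes "continuous_on {\<alpha>..\<beta>} p" "continuous_on {\<alpha>..\<beta>} \<kappa>"
  shows "(\<lambda>w. integral {\<alpha>..\<beta>} (\<lambda>t::real. sinh (w * p t) * \<kappa> t)) holomorphic_on (UNIV::complex set)"
proof -
  have d: "((\<lambda>w. sinh (w * p t) * \<kappa> t) has_field_derivative (exp (w * p t) + exp (- (w * p t))) / 2 * p t * \<kappa> t)
       (at w within UNIV)" for w t
    unfolding sinh_eq_exp by (auto intro!: derivative_eq_intros simp: field_simps)
  have i: "(\<lambda>t. sinh (w * p t) * \<kappa> t) integrable_on {\<alpha>..\<beta>}" for w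
    unfolding sinh_eq_exp by (intro integrable_continuous_real continuous_intros assms) auto
  have c: "continuous_on (UNIV \<times> {\<alpha>..\<beta>}) (\<lambda>(w, t). (exp (w * p t) + exp (- (w * p t))) / 2 * p t * \<kappa> t)"
    unfolding case_prod_unfold
    by (intro continuous_intros continuous_on_compose2[OF assms(1)] continuous_on_compose2[OF assms(2)]) auto
  have "(\<lambda>w. integral (cbox \<alpha> \<beta>) (\<lambda>t. sinh (w * p t) * \<kappa> t)) holomorphic_on UNIV"
    by (rule leibniz_rule_holomorphic[where fx = "\<lambda>w t. (exp (w * p t) + exp (- (w * p t))) / 2 * p t * \<kappa> t"])
      (use c d i in auto)
  then show ?thesis by simp
qed

text \<open>The contribution of the right half of the straight part of \<open>\<Omega>\<close>, as a function of
  \<open>w = Q / 2 - z\<close>.\<close>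

definition tail :: "real \<Rightarrow> complex \<Rightarrow> complex" where
  "tail b w = (LINT t:{pi * b..}|lborel. sinh (w * of_real t) * kern b (of_real t))"

lemma continuous_on_tail_integrand:
  assumes "0 < b" "0 < c"
  shows "continuous_on {c..} (\<lambda>t. sinh (w * complex_of_real t) * kern b (of_real t))"
  by (rule continuous_on_mult[OF continuous_on_sinh_of_real_mult continuous_on_kern_real]) (use assms in auto)

text \<open>The bound does not depend on \<open>Im w\<close>: the tails do not contribute to the growth of \<open>S_b\<close>.\<close>

lemma tail_bounds:
  assumes b: "0 < b" and A: "A < Qb b / 2"
  obtains C where "0 \<le> C"
    "\<And>w c. \<bar>Re w\<bar> \<le> A \<Longrightarrow> pi * b \<le> c \<Longrightarrow>
       set_integrable lborel {c..} (\<lambda>t. sinh (w * of_real t) * kern b (of_real t))"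
    "\<And>w c. \<bar>Re w\<bar> \<le> A \<Longrightarrow> pi * b \<le> c \<Longrightarrow>
       norm (LINT t:{c..}|lborel. sinh (w * of_real t) * kern b (of_real t)) \<le> C * exp (- (Qb b / 2 - A) * c)"
proof -
  obtain C where C: "0 \<le> C" "\<And>t. pi * b \<le> t \<Longrightarrow> norm (kern b (of_real t)) \<le> C * exp (- (Qb b / 2) * t)"
    using norm_kern_real_le[OF b] by metis
  have a: "0 < Qb b / 2 - A" using A by simp
  have pb: "0 < pi * b" using b by simp
  show ?thesis
  proof (rule that[of "C / (Qb b / 2 - A)"])
    show "0 \<le> C / (Qb b / 2 - A)" using C a by simp
    fix w :: complex and c assume w: "\<bar>Re w\<bar> \<le> A" and c: "pi * b \<le> c"
    have n: "norm (sinh (w * of_real t) * kern b (of_real t)) \<le> C * exp (- (Qb b / 2 - A) * t)" if "t \<in> {c..}" for t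
      by (rule norm_tail_integrand_le) (use C w c pb that in auto)
    have cp: "0 < c" using c pb by simp
    note * = set_integrable_bounded_by[OF continuous_on_tail_integrand _ set_integrable_exp_decay(1)[OF a] n]
    show "set_integrable lborel {c..} (\<lambda>t. sinh (w * of_real t) * kern b (of_real t))"
      by (rule *(1)) (use b cp in auto)
    have "norm (LINT t:{c..}|lborel. sinh (w * of_real t) * kern b (of_real t)) \<le> (LINT t:{c..}|lborel. C * exp (- (Qb b / 2 - A) * t))"
      by (rule *(2)) (use b cp in auto)
    then show "norm (LINT t:{c..}|lborel. sinh (w * of_real t) * kern b (of_real t)) \<le> C / (Qb b / 2 - A) * exp (- (Qb b / 2 - A) * c)"
      unfolding set_integrable_exp_decay(2)[OF a] by simp
  qed
qed

text \<open>The tail is the locally uniform limit of integrals over bounded intervals, which are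
  holomorphic by differentiation under the integral sign.\<close>

lemma tail_holomorphic:
  assumes b: "0 < b"
  shows "tail b holomorphic_on {w. \<bar>Re w\<bar> < Qb b / 2}"
proof (rule holomorphic_uniform_sequence)
  let ?h = "\<lambda>w t. sinh (w * of_real t) * kern b (of_real t)"
  let ?F = "\<lambda>n w. integral {pi * b..pi * b + real n} (?h w)"
  have pb: "0 < pi * b" using b by simp
  show "open {w. \<bar>Re w\<bar> < Qb b / 2}" by (intro open_Collect_less continuous_intros)
  show "?F n holomorphic_on {w. \<bar>Re w\<bar> < Qb b / 2}" for n
  proof (rule holomorphic_on_subset[OF sinh_transform_holomorphic])
    show "continuous_on {pi * b..pi * b + real n} (\<lambda>t. kern b (complex_of_real t))"
      by (rule continuous_on_kern_real[OF b]) (use pb in \<open>simp add: not_le\<close>)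
  qed (auto intro!: continuous_intros)
  fix x assume x: "x \<in> {w. \<bar>Re w\<bar> < Qb b / 2}"
  \<comment> \<open>Half the distance from \<open>x\<close> to the boundary of the strip.\<close>
  define d where "d = (Qb b / 2 - \<bar>Re x\<bar>) / 2"
  define A where "A = \<bar>Re x\<bar> + d"
  have d: "d > 0" "A < Qb b / 2" using x by (auto simp: d_def A_def field_simps)
  have near: "\<bar>Re w\<bar> \<le> A" if "w \<in> cball x d" for w
    using that abs_Re_le_cmod[of "x - w"] by (auto simp: A_def dist_norm)
  obtain C where C: "0 \<le> C"
    "\<And>w c. \<bar>Re w\<bar> \<le> A \<Longrightarrow> pi * b \<le> c \<Longrightarrow> set_integrable lborel {c..} (?h w)"
    "\<And>w c. \<bar>Re w\<bar> \<le> A \<Longrightarrow> pi * b \<le> c \<Longrightarrow> norm (LINT t:{c..}|lborel. ?h w t) \<le> C * exp (- (Qb b / 2 - A) * c)"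
    by (rule tail_bounds[OF b d(2)]) (rule that)
  have diff: "norm (?F n w - tail b w) \<le> C * exp (- (Qb b / 2 - A) * (pi * b + real n))" if w: "w \<in> cball x d" for w n
  proof -
    let ?c = "pi * b + real n"
    have i1: "set_integrable lborel {pi * b..?c} (?h w)"
      by (rule set_integrable_subset[OF C(2)[OF near[OF w] order_refl]]) auto
    have i1': "set_integrable lborel {pi * b..<?c} (?h w)"
      by (rule set_integrable_subset[OF i1]) auto
    have i2: "set_integrable lborel {?c..} (?h w)" by (rule C(2)[OF near[OF w]]) simp
    have "tail b w = (LINT t:{pi * b..<?c} \<union> {?c..}|lborel. ?h w t)"
      unfolding tail_def by (rule arg_cong[where f = "\<lambda>S. set_lebesgue_integral lborel S (?h w)"]) auto
    also have "\<dots> = (LINT t:{pi * b..<?c}|lborel. ?h w t) + (LINT t:{?c..}|lborel. ?h w t)"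
      by (rule set_integral_Un[OF _ i1' i2]) auto
    also have "(LINT t:{pi * b..<?c}|lborel. ?h w t) = ?F n w"
      unfolding set_borel_integral_eq_integral(2)[OF i1']
      by (rule integral_subset_negligible) (auto intro: negligible_subset[of "{?c}"])
    finally have "?F n w - tail b w = - (LINT t:{?c..}|lborel. ?h w t)" by simp
    then show ?thesis using C(3)[OF near[OF w], of ?c] by simp
  qed
  have lim: "(\<lambda>n. C * exp (- (Qb b / 2 - A) * (pi * b + real n))) \<longlonglongrightarrow> 0"
    using d(2) by real_asymp
  have "uniform_limit (cball x d) ?F (tail b) sequentially"
    unfolding uniform_limit_iff
  proof (intro allI impI)
    fix e :: real assume "e > 0"
    with lim have "\<forall>\<^sub>F n in sequentially. C * exp (- (Qb b / 2 - A) * (pi * b + real n)) < e"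
      by (rule order_tendstoD)
    then show "\<forall>\<^sub>F n in sequentially. \<forall>w\<in>cball x d. dist (?F n w) (tail b w) < e"
    proof eventually_elim
      case (elim n)
      show ?case
        unfolding dist_norm by (intro ballI le_less_trans[OF diff elim])
    qed
  qed
  moreover have "cball x d \<subseteq> {w. \<bar>Re w\<bar> < Qb b / 2}"
    using le_less_trans[OF near d(2)] by blast
  ultimately show "\<exists>d. 0 < d \<and> cball x d \<subseteq> {w. \<bar>Re w\<bar> < Qb b / 2} \<and> uniform_limit (cball x d) ?F (tail b) sequentially"
    using d(1) by blast
qed

section \<open>Holomorphy and growth of the double sine function\<close>

text \<open>The integrand is an even function of \<open>t\<close>, so both tails agree.\<close>

lemma Omega_integral_S_integrand:
  assumes b: "0 < b"
  shows "Omega_integral (pi * b) (S_integrand b z) =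
    2 * tail b (of_real (Qb b) / 2 - z) +
    contour_integral (part_circlepath 0 (pi * b) pi 0) (\<lambda>t. sinh ((of_real (Qb b) / 2 - z) * t) * kern b t)"
proof -
  have "(LINT t:{..- (pi * b)}|lborel. S_integrand b z (of_real t)) = tail b (of_real (Qb b) / 2 - z)"
  proof -
    have [simp]: "{x. pi * b \<le> x} = {pi * b..}" by auto
    show ?thesis
      by (subst set_integral_reflect) (simp add: tail_def S_integrand_eq kern_minus)
  qed
  then show ?thesis
    by (simp add: Omega_integral_def tail_def S_integrand_eq[abs_def])
qed

lemma S_b_holomorphic:
  assumes b: "0 < b" "b < 1"
  shows "S_b b holomorphic_on {z. 0 < Re z \<and> Re z < Qb b}"
proof -
  let ?D = "{z. 0 < Re z \<and> Re z < Qb b}"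
  let ?w = "\<lambda>z. of_real (Qb b) / 2 - z"
  let ?arc = "\<lambda>w. contour_integral (part_circlepath 0 (pi * b) pi 0) (\<lambda>t. sinh (w * t) * kern b t)"
  have "?arc = (\<lambda>w. (arc_exp b 0 pi (- w) - arc_exp b 0 pi w) / 2)"
    using arc_integral_eq[OF b] by auto
  also have "\<dots> = (\<lambda>w. - integral {0..pi} (\<lambda>\<theta>. sinh (w * (of_real (pi * b) * cis \<theta>)) * arc_weight b \<theta>))"
    using integral_unique[OF arc_sinh_has_integral[OF b, of _ 0 pi]] by (auto simp: field_simps)
  finally have "?arc holomorphic_on UNIV"
    by (auto intro!: holomorphic_intros sinh_transform_holomorphic continuous_on_arc_weight b continuous_intros simp del: of_real_mult)
  then have arc: "(\<lambda>z. ?arc (?w z)) holomorphic_on ?D"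
    by (rule holomorphic_on_compose_gen[where f = ?w and t = UNIV, unfolded o_def, rotated])
      (auto intro!: holomorphic_intros)
  have tl: "(\<lambda>z. tail b (?w z)) holomorphic_on ?D"
    by (rule holomorphic_on_compose_gen[where f = ?w, OF _ tail_holomorphic[OF b(1)], unfolded o_def])
      (auto intro!: holomorphic_intros simp: abs_if)
  show ?thesis
    unfolding S_b_def Omega_integral_S_integrand[OF b(1)]
    by (intro holomorphic_intros arc tl)
qed

text \<open>The exponent is sharp: it is the one of the asymptotic expansion of \<open>S_b\<close> as
  \<open>Im z\<close> tends to plus or minus infinity.\<close>

lemma norm_S_b_le:
  assumes b: "0 < b" "b < 1" and x: "0 < x0" "x1 < Qb b"
  obtains C where "0 < C" "\<And>z. x0 \<le> Re z \<Longrightarrow> Re z \<le> x1 \<Longrightarrow>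
    norm (S_b b z) \<le> C * exp (- pi * (Qb b / 2 - Re z) * \<bar>Im z\<bar>)"
proof -
  \<comment> \<open>The largest value of \<open>\<bar>Re (Q / 2 - z)\<bar>\<close> for \<open>x0 \<le> Re z \<le> x1\<close>.\<close>
  define A where "A = max (Qb b / 2 - x0) (x1 - Qb b / 2)"
  have A: "A < Qb b / 2" unfolding A_def using x by linarith
  let ?arc = "\<lambda>w. contour_integral (part_circlepath 0 (pi * b) pi 0) (\<lambda>t. sinh (w * t) * kern b t)"
  obtain C1 where C1: "\<And>w. \<bar>Re w\<bar> \<le> A \<Longrightarrow> Re (?arc w) \<le> C1 - pi * Re w * \<bar>Im w\<bar>"
    by (rule Re_arc_integral_le[OF b]) (rule that)
  obtain C2 where C2: "\<And>w c. \<bar>Re w\<bar> \<le> A \<Longrightarrow> pi * b \<le> c \<Longrightarrow>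
       norm (LINT t:{c..}|lborel. sinh (w * of_real t) * kern b (of_real t)) \<le> C2 * exp (- (Qb b / 2 - A) * c)"
    by (rule tail_bounds[OF b(1) A]) (rule that)
  define K where "K = 2 * (C2 * exp (- (Qb b / 2 - A) * (pi * b))) + C1"
  show ?thesis
  proof (rule that[of "exp K"])
    fix z assume z: "x0 \<le> Re z" "Re z \<le> x1"
    let ?w = "of_real (Qb b) / 2 - z"
    have w: "\<bar>Re ?w\<bar> \<le> A" using z by (auto simp: A_def)
    have "Re (tail b ?w) \<le> C2 * exp (- (Qb b / 2 - A) * (pi * b))"
      using C2[OF w order_refl] complex_Re_le_cmod order_trans unfolding tail_def by blast
    then have "Re (Omega_integral (pi * b) (S_integrand b z)) \<le> K - pi * Re ?w * \<bar>Im ?w\<bar>"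
      unfolding Omega_integral_S_integrand[OF b(1)] using C1[OF w] by (simp add: K_def)
    then show "norm (S_b b z) \<le> exp K * exp (- pi * (Qb b / 2 - Re z) * \<bar>Im z\<bar>)"
      unfolding S_b_def norm_exp_eq_Re exp_add[symmetric] by simp
  qed simp
qed

lemma norm_T_b: "norm (T_b b z) = exp (pi * (Re z - Qb b / 2) * Im z)"
  unfolding T_b_def norm_exp_eq_Re by (simp add: power2_eq_square algebra_simps)

section \<open>Integrals over vertical lines\<close>

lemma integrable_exp_abs_decay:
  assumes "0 < (e::real)"
  shows "integrable lborel (\<lambda>y. M * exp (- e * \<bar>y\<bar>))"
proof -
  let ?g = "\<lambda>y. indicator {0..} y *\<^sub>R (M * exp (- e * y))"
  have 1: "integrable lborel ?g"
    using set_integrable_exp_decay(1)[OF assms, of 0 M] unfolding set_integrable_def .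
  have 2: "integrable lborel (\<lambda>y. ?g (0 + - 1 * y))"
    by (rule lborel_integrable_real_affine[OF 1]) simp
  have 3: "integrable lborel (\<lambda>y. norm (?g y) + norm (?g (0 + - 1 * y)))"
    by (rule Bochner_Integration.integrable_add[OF integrable_norm[OF 1] integrable_norm[OF 2]])
  show ?thesis
  proof (rule Bochner_Integration.integrable_bound[OF 3])
    show "(\<lambda>y. M * exp (- e * \<bar>y\<bar>)) \<in> borel_measurable lborel" by measurable
    show "AE y in lborel. norm (M * exp (- e * \<bar>y\<bar>)) \<le> norm (norm (?g y) + norm (?g (0 + - 1 * y)))"
    proof (rule AE_I2)
      fix y :: real
      show "norm (M * exp (- e * \<bar>y\<bar>)) \<le> norm (norm (?g y) + norm (?g (0 + - 1 * y)))"
        by (cases "0 \<le> y") simp_all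
    qed
  qed
qed

lemma vertical_line_integrable:
  fixes G :: "complex \<Rightarrow> complex"
  assumes "continuous_on {z. Re z = c} G" "0 < e" "\<And>y. norm (G (Complex c y)) \<le> M * exp (- e * \<bar>y\<bar>)"
  shows "integrable lborel (\<lambda>y. G (Complex c y))"
proof (rule Bochner_Integration.integrable_bound[OF integrable_exp_abs_decay[OF assms(2), of M]])
  have "continuous_on UNIV (\<lambda>y. G (Complex c y))"
    by (rule continuous_on_compose2[OF assms(1)]) (auto simp: Complex_eq intro!: continuous_intros)
  then show "(\<lambda>y. G (Complex c y)) \<in> borel_measurable lborel"
    by (simp add: borel_measurable_continuous_onI)
  show "AE y in lborel. norm (G (Complex c y)) \<le> norm (M * exp (- e * \<bar>y\<bar>))"
    by (rule AE_I2, unfold real_norm_def, rule order_trans[OF assms(3) abs_ge_self])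
qed

text \<open>On a strip, \<open>G\<close> has a primitive \<open>H\<close>.  The integral of \<open>G\<close> over a vertical segment is, up to
  the factor \<open>- \<i>\<close>, the difference of the values of \<open>H\<close> at its end points, and the decay of \<open>G\<close>
  makes the values of \<open>H\<close> on the two lines agree in the limit.\<close>

lemma vertical_line_integral_shift:
  assumes hol: "G holomorphic_on {z. l < Re z \<and> Re z < u}"
    and c: "l < c" "c \<le> c'" "c' < u" and e: "0 < e"
    and bd: "\<And>x y. c \<le> x \<Longrightarrow> x \<le> c' \<Longrightarrow> norm (G (Complex x y)) \<le> M * exp (- e * \<bar>y\<bar>)"
  shows "(LINT y|lborel. G (Complex c y)) = (LINT y|lborel. G (Complex c' y))"
proof -
  let ?S = "{z. l < Re z \<and> Re z < u}"
  have S: "open ?S" "convex ?S"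
    by (auto intro!: open_Collect_conj open_Collect_less continuous_intros
        simp: Collect_conj_eq intro!: convex_Int convex_halfspace_Re_gt convex_halfspace_Re_lt)
  have cont: "continuous_on ?S G" using hol by (rule holomorphic_on_imp_continuous_on)
  obtain H where H': "\<And>z. z \<in> ?S \<Longrightarrow> (H has_field_derivative G z) (at z within ?S)"
    by (rule holomorphic_convex_primitive[OF S(2) finite.emptyI cont])
      (use hol S in \<open>auto simp: interior_open intro: holomorphic_on_imp_differentiable_at\<close>)
  have H: "(H has_field_derivative G z) (at z)" if "z \<in> ?S" for z
    using H'[OF that] at_within_open[OF that S(1)] by simp
  have lim: "(\<lambda>n. - \<i> * (H (Complex x (real n)) - H (Complex x (- real n)))) \<longlonglongrightarrow> (LINT y|lborel. G (Complex x y))"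
    if x: "c \<le> x" "x \<le> c'" for x
  proof -
    have int: "integrable lborel (\<lambda>y. G (Complex x y))"
      by (rule vertical_line_integrable[OF continuous_on_subset[OF cont] e bd[OF x]]) (use x c in auto)
    have "(LINT y:{-real n..real n}|lborel. G (Complex x y)) = - \<i> * (H (Complex x (real n)) - H (Complex x (- real n)))" for n
    proof -
      have "((\<lambda>y. G (Complex x y)) has_integral - \<i> * H (Complex x (real n)) - - \<i> * H (Complex x (- real n))) {-real n..real n}"
      proof (rule fundamental_theorem_of_calculus)
        fix y assume "y \<in> {-real n..real n}"
        have "((\<lambda>y. H (Complex x y)) has_vector_derivative \<i> * G (Complex x y)) (at y within {-real n..real n})"
        proof (rule field_vector_diff_chain_within[where f = "Complex x" and g = H, unfolded o_def])
          show "(Complex x has_vector_derivative \<i>) (at y within {-real n..real n})"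
            unfolding Complex_eq by (auto intro!: derivative_eq_intros)
          show "(H has_field_derivative G (Complex x y)) (at (Complex x y) within Complex x ` {-real n..real n})"
            by (rule has_field_derivative_at_within[OF H]) (use x c in auto)
        qed
        from has_vector_derivative_mult_right[OF this, of "- \<i>"]
        show "((\<lambda>y. - \<i> * H (Complex x y)) has_vector_derivative G (Complex x y)) (at y within {-real n..real n})"
          by simp
      qed simp
      from integral_unique[OF this]
      have "integral {-real n..real n} (\<lambda>y. G (Complex x y)) =
          - \<i> * (H (Complex x (real n)) - H (Complex x (- real n)))"
        by (simp add: algebra_simps)
      moreover have s: "set_integrable lborel {-real n..real n} (\<lambda>y. G (Complex x y))"
        by (rule set_integrable_subset[of lborel UNIV]) (use int in \<open>auto simp: set_integrable_def\<close>)
      ultimately show ?thesis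
        unfolding set_borel_integral_eq_integral(2)[OF s] by simp
    qed
    moreover have "(\<lambda>n. LINT y:{-real n..real n}|lborel. G (Complex x y)) \<longlonglongrightarrow> (LINT y|lborel. G (Complex x y))"
      unfolding set_lebesgue_integral_def
    proof (rule integral_dominated_convergence[where w = "\<lambda>y. norm (G (Complex x y))"])
      show "AE y in lborel. (\<lambda>n. indicator {-real n..real n} y *\<^sub>R G (Complex x y)) \<longlonglongrightarrow> G (Complex x y)"
      proof (rule AE_I2)
        fix y :: real
        have "\<forall>\<^sub>F n in sequentially. real n \<ge> \<bar>y\<bar>"
          by (meson eventually_sequentiallyI nat_ceiling_le_eq)
        then have "\<forall>\<^sub>F n in sequentially. indicator {-real n..real n} y *\<^sub>R G (Complex x y) = G (Complex x y)"
          by eventually_elim (auto simp: indicator_def)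
        then show "(\<lambda>n. indicator {-real n..real n} y *\<^sub>R G (Complex x y)) \<longlonglongrightarrow> G (Complex x y)"
          by (rule tendsto_eventually)
      qed
    qed (use int in \<open>auto simp: indicator_def borel_measurable_integrable intro!: AE_I2\<close>)
    ultimately show ?thesis by simp
  qed
  have dif: "norm (H (Complex c y) - H (Complex c' y)) \<le> M * exp (- e * \<bar>y\<bar>) * (c' - c)" for y
  proof -
    let ?R = "{z. c \<le> Re z \<and> Re z \<le> c' \<and> Im z = y}"
    have "convex ?R"
      using convex_halfspace_Re_ge[of c] convex_halfspace_Re_le[of c'] convex_hyperplane[of \<i> y]
      by (auto simp: Collect_conj_eq intro!: convex_Int)
    then have "norm (H (Complex c y) - H (Complex c' y)) \<le> M * exp (- e * \<bar>y\<bar>) * norm (Complex c y - Complex c' y)"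
    proof (rule field_differentiable_bound)
      fix z assume z: "z \<in> ?R"
      then show "(H has_field_derivative G z) (at z within ?R)"
        using c by (intro has_field_derivative_at_within[OF H]) auto
      show "norm (G z) \<le> M * exp (- e * \<bar>y\<bar>)" using bd[of "Re z" "Im z"] z by simp
    qed (use c in auto)
    also have "norm (Complex c y - Complex c' y) = c' - c" using c by (simp add: cmod_def)
    finally show ?thesis .
  qed
  have l0: "(\<lambda>n. M * exp (- e * real n) * (c' - c)) \<longlonglongrightarrow> 0" using e by real_asymp
  have d0: "(\<lambda>n. H (Complex c (real n)) - H (Complex c' (real n))) \<longlonglongrightarrow> 0"
    by (rule Lim_null_comparison[OF always_eventually l0]) (use dif[of "real n" for n] in simp)
  have d1: "(\<lambda>n. H (Complex c (- real n)) - H (Complex c' (- real n))) \<longlonglongrightarrow> 0"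
    by (rule Lim_null_comparison[OF always_eventually l0]) (use dif[of "- real n" for n] in simp)
  have "(\<lambda>n. - \<i> * (H (Complex c (real n)) - H (Complex c (- real n))) - - \<i> * (H (Complex c' (real n)) - H (Complex c' (- real n))))
      \<longlonglongrightarrow> (LINT y|lborel. G (Complex c y)) - (LINT y|lborel. G (Complex c' y))"
    using c by (intro tendsto_diff lim) auto
  moreover have "(\<lambda>n. - \<i> * (H (Complex c (real n)) - H (Complex c' (real n))) + \<i> * (H (Complex c (- real n)) - H (Complex c' (- real n))))
      \<longlonglongrightarrow> - \<i> * 0 + \<i> * 0"
    by (intro tendsto_intros d0 d1)
  ultimately have "(LINT y|lborel. G (Complex c y)) - (LINT y|lborel. G (Complex c' y)) = 0"
    by (intro LIMSEQ_unique) (auto simp: algebra_simps)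
  then show ?thesis by simp
qed

section \<open>The integrand on vertical lines\<close>

text \<open>On the line \<open>Re u = x\<close> the factors \<open>T_b\<close> contribute \<open>exp (pi * (3 * x - 13 * Q / 2) * y)\<close> and the
  factors \<open>S_b\<close> contribute \<open>exp (- 3 * pi * (x - 3 * Q / 2) * \<bar>y\<bar>)\<close>, up to constants.  The product
  decays like \<open>exp (- 2 * pi * Q * y)\<close> for \<open>y \<rightarrow> \<infinity>\<close> and like \<open>exp (- pi * (6 * x - 11 * Q) * \<bar>y\<bar>)\<close>
  for \<open>y \<rightarrow> - \<infinity>\<close>.  The second rate is the smaller one on the strip in question, and it is
  positive exactly for \<open>x > 11 * Q / 6\<close>.\<close>

lemma norm_sixj_integrand_le:
  fixes b :: real and a :: "nat \<Rightarrow> complex"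
  defines "Q \<equiv> Qb b"
  assumes b: "0 < b" "b < 1"
    and t: "\<And>i. Re (tt a i) = 3 * Q / 2"
    and q: "\<And>j. Re (qq a j) = 2 * Q"
    and c: "11 * Q / 6 < c" "c' < 2 * Q"
  obtains M where "\<And>x y. c \<le> x \<Longrightarrow> x \<le> c' \<Longrightarrow>
    norm (sixj_integrand b a (Complex x y)) \<le> M * exp (- (pi * (6 * c - 11 * Q)) * \<bar>y\<bar>)"
proof -
  have Q: "Q > 0" using b by (simp add: Q_def Qb_def add_pos_pos)
  have x01: "0 < 2 * Q - c'" "2 * Q - c < Qb b" using c Q by (auto simp: Q_def)
  obtain C where C: "0 < C" "\<And>z. 2 * Q - c' \<le> Re z \<Longrightarrow> Re z \<le> 2 * Q - c \<Longrightarrow>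
    norm (S_b b z) \<le> C * exp (- pi * (Qb b / 2 - Re z) * \<bar>Im z\<bar>)"
    by (rule norm_S_b_le[OF b x01]) (rule that)
  define P where "P = (\<Prod>i=1..4. exp (pi * Q * \<bar>Im (tt a i)\<bar>))"
  define R where "R = (\<Prod>j=1..3. exp (pi * Q * \<bar>Im (qq a j)\<bar>))"
  show ?thesis
  proof (rule that[of "P * C ^ 3 * R"])
    fix x y assume x: "c \<le> x" "x \<le> c'"
    \<comment> \<open>The imaginary parts of the parameters only affect the constant, because
      \<open>\<bar>x - 2 * Q\<bar> \<le> Q\<close> and \<open>0 \<le> x - 3 * Q / 2 \<le> Q\<close>.\<close>
    let ?u = "Complex x y"
    have T: "norm (T_b b (?u - tt a i)) \<le> exp (pi * (x - 2 * Q) * y) * exp (pi * Q * \<bar>Im (tt a i)\<bar>)" for i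
    proof -
      have "\<bar>(x - 2 * Q) * Im (tt a i)\<bar> \<le> Q * \<bar>Im (tt a i)\<bar>"
        unfolding abs_mult using x c Q by (intro mult_right_mono) auto
      then have "(x - 2 * Q) * (y - Im (tt a i)) \<le> (x - 2 * Q) * y + Q * \<bar>Im (tt a i)\<bar>"
        by (simp add: algebra_simps abs_le_iff)
      then have "pi * ((x - 2 * Q) * (y - Im (tt a i))) \<le> pi * ((x - 2 * Q) * y + Q * \<bar>Im (tt a i)\<bar>)"
        by (intro mult_left_mono) auto
      then have "exp (pi * (x - 2 * Q) * (y - Im (tt a i))) \<le> exp (pi * (x - 2 * Q) * y) * exp (pi * Q * \<bar>Im (tt a i)\<bar>)"
        unfolding exp_add[symmetric] by (simp add: algebra_simps)
      moreover have e: "Re (?u - tt a i) - Qb b / 2 = x - 2 * Q" "Im (?u - tt a i) = y - Im (tt a i)"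
        using t[of i] by (simp_all flip: Q_def)
      ultimately show ?thesis
        unfolding norm_T_b e by simp
    qed
    have S: "norm (S_b b (qq a j - ?u)) \<le> (C * exp (- pi * (x - 3 * Q / 2) * \<bar>y\<bar>)) * exp (pi * Q * \<bar>Im (qq a j)\<bar>)" for j
    proof -
      let ?k = "x - 3 * Q / 2"
      have k: "0 \<le> ?k" "?k \<le> Q" using x c Q by auto
      have "?k * \<bar>y\<bar> \<le> ?k * (\<bar>Im (qq a j) - y\<bar> + \<bar>Im (qq a j)\<bar>)"
        using k by (intro mult_left_mono) auto
      also have "\<dots> \<le> ?k * \<bar>Im (qq a j) - y\<bar> + Q * \<bar>Im (qq a j)\<bar>"
        unfolding distrib_left using k by (intro add_left_mono mult_right_mono) auto
      finally have "pi * (?k * \<bar>y\<bar>) \<le> pi * (?k * \<bar>Im (qq a j) - y\<bar> + Q * \<bar>Im (qq a j)\<bar>)"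
        by (intro mult_left_mono) auto
      then have "exp (- pi * ?k * \<bar>Im (qq a j) - y\<bar>) \<le> exp (- pi * ?k * \<bar>y\<bar> + pi * Q * \<bar>Im (qq a j)\<bar>)"
        by (simp add: algebra_simps)
      then have e: "C * exp (- pi * ?k * \<bar>Im (qq a j) - y\<bar>) \<le> C * exp (- pi * ?k * \<bar>y\<bar>) * exp (pi * Q * \<bar>Im (qq a j)\<bar>)"
        unfolding exp_add using C(1) by simp
      have "norm (S_b b (qq a j - ?u)) \<le> C * exp (- pi * (Qb b / 2 - Re (qq a j - ?u)) * \<bar>Im (qq a j - ?u)\<bar>)"
        by (rule C(2)) (use q[of j] x in auto)
      also have "Qb b / 2 - Re (qq a j - ?u) = ?k" using q[of j] by (simp flip: Q_def)
      finally show ?thesis using e by simp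
    qed
    have "(\<Prod>i=1..4. norm (T_b b (?u - tt a i))) \<le>
        (\<Prod>i=1..4. exp (pi * (x - 2 * Q) * y) * exp (pi * Q * \<bar>Im (tt a i)\<bar>))"
      by (intro prod_mono conjI norm_ge_zero T)
    also have "\<dots> = exp (pi * (x - 2 * Q) * y) ^ 4 * P"
      unfolding prod.distrib P_def by simp
    finally have T4: "(\<Prod>i=1..4. norm (T_b b (?u - tt a i))) \<le> exp (pi * (x - 2 * Q) * y) ^ 4 * P" .
    have "(\<Prod>j=1..3. norm (S_b b (qq a j - ?u))) \<le>
        (\<Prod>j=1..3. (C * exp (- pi * (x - 3 * Q / 2) * \<bar>y\<bar>)) * exp (pi * Q * \<bar>Im (qq a j)\<bar>))"
      by (intro prod_mono conjI norm_ge_zero S)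
    also have "\<dots> = (C * exp (- pi * (x - 3 * Q / 2) * \<bar>y\<bar>)) ^ 3 * R"
      unfolding prod.distrib[of "\<lambda>_. C * _"] R_def by simp
    finally have S3: "(\<Prod>j=1..3. norm (S_b b (qq a j - ?u))) \<le>
        (C * exp (- pi * (x - 3 * Q / 2) * \<bar>y\<bar>)) ^ 3 * R" .
    have T1: "norm (T_b b (2 * of_real (Qb b) - ?u)) = exp (- (pi * (3 * Q / 2 - x) * y))"
      unfolding norm_T_b by (simp add: algebra_simps flip: Q_def)
    have PR: "0 \<le> P" "0 \<le> R" by (auto simp: P_def R_def intro: prod_nonneg)
    have "norm (sixj_integrand b a ?u) = (\<Prod>i=1..4. norm (T_b b (?u - tt a i))) / exp (- (pi * (3 * Q / 2 - x) * y)) *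
        (\<Prod>j=1..3. norm (S_b b (qq a j - ?u)))"
      unfolding sixj_integrand_def norm_mult norm_divide T1 prod_norm ..
    also have "\<dots> \<le> (exp (pi * (x - 2 * Q) * y) ^ 4 * P) / exp (- (pi * (3 * Q / 2 - x) * y)) *
        ((C * exp (- pi * (x - 3 * Q / 2) * \<bar>y\<bar>)) ^ 3 * R)"
      using C(1) PR by (intro mult_mono divide_right_mono T4 S3 prod_nonneg divide_nonneg_pos mult_nonneg_nonneg) auto
    also have "\<dots> = P * C ^ 3 * R * exp (4 * (pi * (x - 2 * Q) * y) + pi * (3 * Q / 2 - x) * y + 3 * (- pi * (x - 3 * Q / 2) * \<bar>y\<bar>))"
    proof -
      have "exp (pi * (x - 2 * Q) * y) ^ 4 = exp (4 * (pi * (x - 2 * Q) * y))"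
        "exp (- pi * (x - 3 * Q / 2) * \<bar>y\<bar>) ^ 3 = exp (3 * (- pi * (x - 3 * Q / 2) * \<bar>y\<bar>))"
        by (simp_all only: exp_of_nat_mult[symmetric] of_nat_numeral)
      moreover have "exp (pi * (3 * Q / 2 - x) * y) = 1 / exp (- (pi * (3 * Q / 2 - x) * y))"
        by (simp add: exp_minus inverse_eq_divide)
      ultimately show ?thesis
        unfolding exp_add power_mult_distrib by (simp only: times_divide_eq_left times_divide_eq_right mult_1_left mult_1_right mult_ac)
    qed
    also have "\<dots> \<le> P * C ^ 3 * R * exp (- (pi * (6 * c - 11 * Q)) * \<bar>y\<bar>)"
    proof (intro mult_left_mono)
      have "4 * ((x - 2 * Q) * y) + (3 * Q / 2 - x) * y - 3 * ((x - 3 * Q / 2) * \<bar>y\<bar>) \<le> - ((6 * c - 11 * Q) * \<bar>y\<bar>)"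
      proof (cases "0 \<le> y")
        case True
        have "0 \<le> (2 * Q - c) * y" using True x c by (intro mult_nonneg_nonneg) auto
        moreover have "0 \<le> Q * y" using True Q by simp
        ultimately show ?thesis using True by (simp add: algebra_simps)
      next
        case False
        have "(x - c) * y \<le> 0" using False x by (intro mult_nonneg_nonpos) auto
        then show ?thesis using False by (simp add: algebra_simps)
      qed
      then have "pi * (4 * ((x - 2 * Q) * y) + (3 * Q / 2 - x) * y - 3 * ((x - 3 * Q / 2) * \<bar>y\<bar>)) \<le> pi * (- ((6 * c - 11 * Q) * \<bar>y\<bar>))"
        by (intro mult_left_mono) auto
      then show "exp (4 * (pi * (x - 2 * Q) * y) + pi * (3 * Q / 2 - x) * y + 3 * (- pi * (x - 3 * Q / 2) * \<bar>y\<bar>))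
          \<le> exp (- (pi * (6 * c - 11 * Q)) * \<bar>y\<bar>)"
        by (simp add: algebra_simps)
    qed (use PR C in auto)
    finally show "norm (sixj_integrand b a ?u) \<le> P * C ^ 3 * R * exp (- (pi * (6 * c - 11 * Q)) * \<bar>y\<bar>)" .
  qed
qed

lemma sixj_integrand_holomorphic:
  assumes b: "0 < b" "b < 1"
    and q: "\<And>j. Re (qq a j) = 2 * Qb b"
  shows "sixj_integrand b a holomorphic_on {u. Qb b < Re u \<and> Re u < 2 * Qb b}"
proof -
  let ?D = "{u. Qb b < Re u \<and> Re u < 2 * Qb b}"
  have T: "(\<lambda>u. T_b b (u - tt a i)) holomorphic_on ?D" "(\<lambda>u. T_b b (2 * of_real (Qb b) - u)) holomorphic_on ?D" for i
    unfolding T_b_def by (intro holomorphic_intros)+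
  have S: "(\<lambda>u. S_b b (qq a j - u)) holomorphic_on ?D" for j
    by (rule holomorphic_on_compose_gen[where f = "\<lambda>u. qq a j - u", OF _ S_b_holomorphic[OF b], unfolded o_def])
      (use q[of j] in \<open>auto intro!: holomorphic_intros\<close>)
  show ?thesis
    unfolding sixj_integrand_def
    by (intro holomorphic_on_mult holomorphic_on_divide holomorphic_on_prod T S) (auto simp: T_b_def)
qed

lemma sixj_integrand_integrable:
  assumes b: "0 < b" "b < 1"
    and t: "\<And>i. Re (tt a i) = 3 * Qb b / 2"
    and q: "\<And>j. Re (qq a j) = 2 * Qb b"
    and c: "11 * Qb b / 6 < c" "c < 2 * Qb b"
  shows "integrable lborel (\<lambda>y. sixj_integrand b a (Complex c y))"
proof -
  have Q: "Qb b > 0" using b by (simp add: Qb_def add_pos_pos)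
  obtain M where M: "\<And>x y. c \<le> x \<Longrightarrow> x \<le> c \<Longrightarrow>
      norm (sixj_integrand b a (Complex x y)) \<le> M * exp (- (pi * (6 * c - 11 * Qb b)) * \<bar>y\<bar>)"
    by (rule norm_sixj_integrand_le[OF b t q c]) (rule that)
  show ?thesis
  proof (rule vertical_line_integrable[OF _ _ M])
    show "continuous_on {z. Re z = c} (sixj_integrand b a)"
      using c Q
      by (intro continuous_on_subset[OF holomorphic_on_imp_continuous_on[OF sixj_integrand_holomorphic[OF b q]]]) auto
  qed (use c in simp_all)
qed

lemma sixj_integral_shift:
  assumes b: "0 < b" "b < 1"
    and t: "\<And>i. Re (tt a i) = 3 * Qb b / 2"
    and q: "\<And>j. Re (qq a j) = 2 * Qb b"
    and c: "11 * Qb b / 6 < c" "c \<le> c'" "c' < 2 * Qb b"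
  shows "sixj_integral b a c = sixj_integral b a c'"
proof -
  have Q: "Qb b > 0" using b by (simp add: Qb_def add_pos_pos)
  obtain M where M: "\<And>x y. c \<le> x \<Longrightarrow> x \<le> c' \<Longrightarrow>
      norm (sixj_integrand b a (Complex x y)) \<le> M * exp (- (pi * (6 * c - 11 * Qb b)) * \<bar>y\<bar>)"
    by (rule norm_sixj_integrand_le[OF b t q c(1,3)]) (rule that)
  show ?thesis
    unfolding sixj_integral_def
    by (rule vertical_line_integral_shift[OF sixj_integrand_holomorphic[OF b q] _ _ _ _ M])
      (use c Q in simp_all)
qed

theorem proposition3p1:
  fixes b :: real and a :: "nat \<Rightarrow> complex"
  assumes "0 < b" and "b < 1"
    and "\<And>i. i \<in> {1..6} \<Longrightarrow> Re (a i) = Qb b / 2"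
  shows "(\<forall>c \<in> {11 * Qb b / 6 <..< 2 * Qb b}.
            integrable lborel (\<lambda>y. sixj_integrand b a (Complex c y))) \<and>
         (\<forall>c \<in> {11 * Qb b / 6 <..< 2 * Qb b}. \<forall>c' \<in> {11 * Qb b / 6 <..< 2 * Qb b}.
            sixj_integral b a c = sixj_integral b a c' \<and>
            sixj_prefactor b a * sixj_integral b a c = sixj_prefactor b a * sixj_integral b a c')"
proof -
  \<comment> \<open>Indices out of range fall into the last branch of the definitions, so none need be excluded.\<close>
  have t: "Re (tt a i) = 3 * Qb b / 2" for i
    unfolding tt_def by (simp add: assms(3))
  have q: "Re (qq a j) = 2 * Qb b" for j
    unfolding qq_def by (simp add: assms(3))
  note int = sixj_integrand_integrable[OF assms(1,2) t q]
  note shift = sixj_integral_shift[OF assms(1,2) t q]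
  have eq: "sixj_integral b a c = sixj_integral b a c'"
    if c: "c \<in> {11 * Qb b / 6 <..< 2 * Qb b}" "c' \<in> {11 * Qb b / 6 <..< 2 * Qb b}" for c c'
  proof (cases "c \<le> c'")
    case True
    with c show ?thesis by (intro shift) auto
  next
    case False
    with c have "sixj_integral b a c' = sixj_integral b a c" by (intro shift) auto
    then show ?thesis by (rule sym)
  qed
  show ?thesis
    by (intro conjI ballI eq int arg_cong[where f = "(*) (sixj_prefactor b a)"]) auto
qed

end
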